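(* Let $\Lambda$ be a lattice in $\mathbb{R}^d$, let $F:\mathbb{R}^d\to[0,\infty]$ be $\Lambda$-periodic, and suppose $g\in L^2(\Omega_\Lambda)$ is conditionally positive semi-definite with $g\le F$. Then for any $n$-point configuration $\omega_n=\{x_1,\dots,x_n\}\subset\mathbb{R}^d$, $$E_F(\omega_n)\ \ge\ E_g(\omega_n)\ \ge\ n^2\hat g_0-n\,g(0),$$ with equality holding throughout if and only if the following two conditions hold: (a) $g(x_i-x_j)=F(x_i-x_j)$ for all $i\neq j$; (b) $\hat g_v M_v(\omega_n)=0$ for all $v\in\Lambda^*\setminus\{0\}$. If (a) and (b) hold, then $E_F(\omega_n)=\mathcal{E}_F(n)$.
   Context: $\Lambda=V\mathbb{Z}^d$ with $V$ nonsingular; $\Omega_\Lambda=V[0,1)^d$; $|\Lambda|=|\det V|$; $\Lambda^*=\{v\in\mathbb{R}^d: w\cdot v\in\mathbb{Z}\ \forall w\in\Lambda\}$ is the dual lattice. $L^2(\Omega_\Lambda)$ is the Hilbert space of complex-valued $\Lambda$-periodic functions on $\mathbb{R}^d$ that are square integrable on $\Omega_\Lambda$. The Fourier coefficients of $g\in L^2(\Omega_\Lambda)$ are $\hat g_v=\frac1{|\Lambda|}\int_{\Omega_\Lambda}g(x)e^{-2\pi i v\cdot x}\,dx$, $v\in\Lambda^*$. The function $g$ is conditionally positive semi-definite (CPSD) if $\hat g_v\ge0$ for all $v\in\Lambda^*\setminus\{0\}$ and $\sum_{v\in\Lambda^*}\hat g_v<\infty$; such a $g$ is identified with its continuous representative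 $g(x)=\sum_{v\in\Lambda^*}\hat g_v e^{2\pi i v\cdot x}$. An $n$-point configuration is a multiset of cardinality $n$ in $\mathbb{R}^d$. For a potential $F$, $E_F(\omega_n)=\sum_{i=1}^n\sum_{j\neq i}F(x_i-x_j)$ and $\mathcal{E}_F(n)=\inf\{E_F(\omega_n):|\omega_n|=n\}$; $E_g$ is defined likewise. The $v$-moment of $\omega_n$ is $M_v(\omega_n)=\sum_{x\in\omega_n}e^{2\pi i v\cdot x}$ (counted with multiplicity). *)

theory Defs
  imports "HOL-Analysis.Analysis" "HOL-Library.Multiset"
begin

definition lattice_of :: "real^'d^'d \<Rightarrow> (real^'d) set" where
  "lattice_of V = {V *v z | z. \<forall>i. z $ i \<in> \<int>}"

definition fund_domain :: "real^'d^'d \<Rightarrow> (real^'d) set" where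
  "fund_domain V = {V *v t | t. \<forall>i. 0 \<le> t $ i \<and> t $ i < 1}"

definition dual_lattice :: "real^'d^'d \<Rightarrow> (real^'d) set" where
  "dual_lattice V = {v. \<forall>w\<in>lattice_of V. w \<bullet> v \<in> \<int>}"

definition lattice_periodic :: "real^'d^'d \<Rightarrow> (real^'d \<Rightarrow> 'b) \<Rightarrow> bool" where
  "lattice_periodic V f \<longleftrightarrow> (\<forall>x. \<forall>w\<in>lattice_of V. f (x + w) = f x)"

text \<open>The functions below are representatives of elements of the Hilbert space; none of the
  Fourier coefficients depends on the choice of the representative.\<close>

definition L2_periodic :: "real^'d^'d \<Rightarrow> (real^'d \<Rightarrow> complex) set" where
  "L2_periodic V = {g. lattice_periodic V g \<and> g \<in> borel_measurable lebesgue \<and>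
     set_integrable lebesgue (fund_domain V) (\<lambda>x. (norm (g x))\<^sup>2)}"

definition character :: "real^'d \<Rightarrow> real^'d \<Rightarrow> complex" where
  "character v x = exp (2 * of_real pi * \<i> * of_real (v \<bullet> x))"

text \<open>The conjugate character is \<open>character (- v)\<close>.\<close>

definition fourier_coeff :: "real^'d^'d \<Rightarrow> (real^'d \<Rightarrow> complex) \<Rightarrow> real^'d \<Rightarrow> complex" where
  "fourier_coeff V g v =
     1 / of_real \<bar>det V\<bar> * (LINT x:fund_domain V|lebesgue. g x * character (- v) x)"

definition cpsd :: "real^'d^'d \<Rightarrow> (real^'d \<Rightarrow> complex) \<Rightarrow> bool" where
  "cpsd V g \<longleftrightarrow>
     (\<forall>v\<in>dual_lattice V - {0}. fourier_coeff V g v \<in> \<real>\<^sub>\<ge>\<^sub>0) \<and>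
     fourier_coeff V g summable_on dual_lattice V"

text \<open>The continuous representative of a conditionally positive semi-definite \<open>g\<close>. Pointwise
  values of such a \<open>g\<close> always refer to this function.\<close>

definition cont_rep :: "real^'d^'d \<Rightarrow> (real^'d \<Rightarrow> complex) \<Rightarrow> real^'d \<Rightarrow> complex" where
  "cont_rep V g x = (\<Sum>\<^sub>\<infinity>v\<in>dual_lattice V. fourier_coeff V g v * character v x)"

text \<open>Removing a single copy of \<open>x\<close> from the multiset expresses the restriction to indices
  \<open>j \<noteq> i\<close>: coinciding points with different indices still interact.\<close>

definition energy :: "('a::ab_group_add \<Rightarrow> 'b::comm_monoid_add) \<Rightarrow> 'a multiset \<Rightarrow> 'b" where
  "energy f \<omega> = (\<Sum>x\<in>#\<omega>. \<Sum>y\<in>#\<omega> - {#x#}. f (x - y))"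

definition min_energy :: "('a::ab_group_add \<Rightarrow> ennreal) \<Rightarrow> nat \<Rightarrow> ennreal" where
  "min_energy F n = (INF \<omega>\<in>{\<omega>. size \<omega> = n}. energy F \<omega>)"

definition moment :: "real^'d \<Rightarrow> (real^'d) multiset \<Rightarrow> complex" where
  "moment v \<omega> = (\<Sum>x\<in>#\<omega>. character v x)"

end

theory Submission
  imports Defs
begin

text \<open>Expanding the continuous representative of \<open>g\<close> in its Fourier series turns the full double
  sum of \<open>g (x - y)\<close> over a configuration, diagonal included, into
  \<open>\<Sum>v. \<hat>g\<^sub>v \<bar>M\<^sub>v\<bar>\<^sup>2\<close>. The diagonal contributes \<open>n g 0\<close> and the frequency \<open>0\<close> contributes
  \<open>n\<^sup>2 \<hat>g\<^sub>0\<close>; all other frequencies contribute nonnegatively. Since the resulting lower bound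
  depends on the configuration only through \<open>n\<close>, a configuration attaining it is optimal.\<close>

text \<open>The potential may be infinite and the lower bound negative, so the two are compared in
  \<open>ereal\<close>, which contains both ranges.\<close>

lemma enn2ereal_sum_mset_ge:
  assumes "\<And>x. x \<in># M \<Longrightarrow> ereal (r x) \<le> enn2ereal (f x)"
  shows "ereal (\<Sum>x\<in>#M. r x) \<le> enn2ereal (\<Sum>x\<in>#M. f x)"
  using assms
proof (induction M)
  case empty
  show ?case by (simp add: zero_ennreal.rep_eq flip: zero_ereal_def)
next
  case (add a M)
  have "ereal (r a) + ereal (\<Sum>x\<in>#M. r x) \<le> enn2ereal (f a) + enn2ereal (\<Sum>x\<in>#M. f x)"
    using add by (intro add_mono) auto
  then show ?case by (simp add: plus_ennreal.rep_eq)
qed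

text \<open>A sum equal to a real number has only finite terms \<open>f x\<close>; the gaps between
  \<open>f x\<close> and \<open>r x\<close> are then nonnegative reals with sum zero, so each one
  vanishes.\<close>

lemma enn2ereal_sum_mset_eq_iff:
  assumes "\<And>x. x \<in># M \<Longrightarrow> ereal (r x) \<le> enn2ereal (f x)"
  shows "enn2ereal (\<Sum>x\<in>#M. f x) = ereal (\<Sum>x\<in>#M. r x) \<longleftrightarrow>
    (\<forall>x\<in>#M. ereal (r x) = enn2ereal (f x))"
  using assms
proof (induction M)
  case empty
  show ?case by (simp add: zero_ennreal.rep_eq flip: zero_ereal_def)
next
  case (add a M)
  have le: "ereal (r a) \<le> enn2ereal (f a)"
    "ereal (\<Sum>x\<in>#M. r x) \<le> enn2ereal (\<Sum>x\<in>#M. f x)"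
    using add.prems by (auto intro!: enn2ereal_sum_mset_ge)
  have "enn2ereal (f a) + enn2ereal (\<Sum>x\<in>#M. f x) = ereal (r a) + ereal (\<Sum>x\<in>#M. r x) \<longleftrightarrow>
    ereal (r a) = enn2ereal (f a) \<and> enn2ereal (\<Sum>x\<in>#M. f x) = ereal (\<Sum>x\<in>#M. r x)"
    using le by (cases "enn2ereal (f a)"; cases "enn2ereal (\<Sum>x\<in>#M. f x)") auto
  then show ?case using add by (simp add: plus_ennreal.rep_eq)
qed

lemma Re_sum_mset: "Re (\<Sum>x\<in>#M. f x) = (\<Sum>x\<in>#M. Re (f x))"
  by (induction M) auto

lemma cnj_sum_mset: "cnj (\<Sum>x\<in>#M. f x) = (\<Sum>x\<in>#M. cnj (f x))"
  by (induction M) auto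

lemma Re_energy: "Re (energy f \<omega>) = energy (\<lambda>x. Re (f x)) \<omega>"
  by (simp add: energy_def Re_sum_mset)

lemma energy_ge:
  assumes "\<And>x. ereal (r x) \<le> enn2ereal (f x)"
  shows "ereal (energy r \<omega>) \<le> enn2ereal (energy f \<omega>)"
  unfolding energy_def by (intro enn2ereal_sum_mset_ge assms)

lemma energy_eq_iff:
  assumes "\<And>x. ereal (r x) \<le> enn2ereal (f x)"
  shows "enn2ereal (energy f \<omega>) = ereal (energy r \<omega>) \<longleftrightarrow>
    (\<forall>x\<in>#\<omega>. \<forall>y\<in>#\<omega> - {#x#}. ereal (r (x - y)) = enn2ereal (f (x - y)))"
proof -
  have "enn2ereal (energy f \<omega>) = ereal (energy r \<omega>) \<longleftrightarrow>
    (\<forall>x\<in>#\<omega>. enn2ereal (\<Sum>y\<in>#\<omega> - {#x#}. f (x - y)) = ereal (\<Sum>y\<in>#\<omega> - {#x#}. r (x - y)))"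
    unfolding energy_def
    by (subst enn2ereal_sum_mset_eq_iff) (auto intro!: enn2ereal_sum_mset_ge assms)
  also have "\<dots> \<longleftrightarrow>
    (\<forall>x\<in>#\<omega>. \<forall>y\<in>#\<omega> - {#x#}. ereal (r (x - y)) = enn2ereal (f (x - y)))"
    by (subst enn2ereal_sum_mset_eq_iff) (auto intro: assms)
  finally show ?thesis .
qed

text \<open>Each \<open>x\<close> lacks exactly one partner in the energy, a single copy of itself,
  whose contribution would be \<open>f 0\<close>. Only the full double sum factors into
  moments.\<close>

lemma energy_add_diagonal:
  fixes f :: "'a::ab_group_add \<Rightarrow> 'b::comm_semiring_1"
  shows "energy f \<omega> + of_nat (size \<omega>) * f 0 = (\<Sum>x\<in>#\<omega>. \<Sum>y\<in>#\<omega>. f (x - y))"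
proof -
  have "(\<Sum>x\<in>#\<omega>. \<Sum>y\<in>#\<omega>. f (x - y)) = (\<Sum>x\<in>#\<omega>. (\<Sum>y\<in>#\<omega> - {#x#}. f (x - y)) + f 0)"
  proof (intro arg_cong[where f = sum_mset] image_mset_cong)
    fix x assume "x \<in># \<omega>"
    then obtain N where "\<omega> = add_mset x N" by (meson mset_add)
    then show "(\<Sum>y\<in>#\<omega>. f (x - y)) = (\<Sum>y\<in>#\<omega> - {#x#}. f (x - y)) + f 0"
      by (simp add: add.commute)
  qed
  also have "\<dots> = energy f \<omega> + of_nat (size \<omega>) * f 0"
    by (simp add: sum_mset.distrib energy_def)
  finally show ?thesis by simp
qed

lemma has_sum_sum_mset:
  fixes f :: "'a \<Rightarrow> 'b \<Rightarrow> 'c::topological_comm_monoid_add"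
  assumes "\<And>x. x \<in># M \<Longrightarrow> (f x has_sum s x) A"
  shows "((\<lambda>v. \<Sum>x\<in>#M. f x v) has_sum (\<Sum>x\<in>#M. s x)) A"
  using assms by (induction M) (auto intro!: has_sum_add)

lemma norm_character [simp]: "norm (character v x) = 1"
  by (simp add: character_def norm_exp_eq_Re)

lemma character_diff: "character v (x - y) = character v x * cnj (character v y)"
  by (simp add: character_def inner_diff_right exp_cnj right_diff_distrib flip: exp_add)

text \<open>A character of a difference splits into a factor in \<open>x\<close> and a conjugate
  factor in \<open>y\<close>, so the double sum is the moment times its conjugate.\<close>

lemma sum_character_diff:
  "(\<Sum>x\<in>#\<omega>. \<Sum>y\<in>#\<omega>. c * character v (x - y)) = c * of_real ((norm (moment v \<omega>))\<^sup>2)"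
proof -
  have "(\<Sum>x\<in>#\<omega>. \<Sum>y\<in>#\<omega>. c * character v (x - y)) = c * (moment v \<omega> * cnj (moment v \<omega>))"
    unfolding moment_def cnj_sum_mset sum_mset_product
    by (simp add: character_diff sum_mset_distrib_left)
  then show ?thesis by (simp only: complex_norm_square)
qed

lemma moment_zero: "moment 0 \<omega> = of_nat (size \<omega>)"
  by (simp add: moment_def character_def)

lemma zero_in_dual_lattice: "0 \<in> dual_lattice V"
  by (simp add: dual_lattice_def)

text \<open>Summability in the complex numbers is absolute, and characters have modulus 1, so the
  coefficients dominate the series at every \<open>x\<close>.\<close>

lemma cont_rep_has_sum:
  assumes "cpsd V g"
  shows "((\<lambda>v. fourier_coeff V g v * character v x) has_sum cont_rep V g x) (dual_lattice V)"
proof -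
  have "fourier_coeff V g summable_on dual_lattice V" using assms by (simp add: cpsd_def)
  then have "(\<lambda>v. norm (fourier_coeff V g v)) summable_on dual_lattice V"
    by (simp add: summable_on_iff_abs_summable_on_complex)
  then have "(\<lambda>v. norm (fourier_coeff V g v * character v x)) summable_on dual_lattice V"
    by (simp add: norm_mult)
  then show ?thesis
    unfolding cont_rep_def by (rule has_sum_infsum[OF abs_summable_summable])
qed

text \<open>Since the coefficient at \<open>0\<close> need not be real, only the real part of the defect is determined.\<close>

lemma energy_defect_has_sum:
  assumes "cpsd V g"
  shows "((\<lambda>v. Re (fourier_coeff V g v) * (norm (moment v \<omega>))\<^sup>2) has_sum
    (Re (energy (cont_rep V g) \<omega>) - ((real (size \<omega>))\<^sup>2 * Re (fourier_coeff V g 0) -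
      real (size \<omega>) * Re (cont_rep V g 0)))) (dual_lattice V - {0})"
proof -
  have "((\<lambda>v. \<Sum>x\<in>#\<omega>. \<Sum>y\<in>#\<omega>. fourier_coeff V g v * character v (x - y)) has_sum
    (\<Sum>x\<in>#\<omega>. \<Sum>y\<in>#\<omega>. cont_rep V g (x - y))) (dual_lattice V)"
    by (intro has_sum_sum_mset cont_rep_has_sum assms)
  then have "((\<lambda>v. Re (fourier_coeff V g v * of_real ((norm (moment v \<omega>))\<^sup>2))) has_sum
    Re (energy (cont_rep V g) \<omega> + of_nat (size \<omega>) * cont_rep V g 0)) (dual_lattice V)"
    unfolding sum_character_diff energy_add_diagonal by (rule has_sum_Re)
  then have "((\<lambda>v. Re (fourier_coeff V g v) * (norm (moment v \<omega>))\<^sup>2) has_sum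
    (Re (energy (cont_rep V g) \<omega>) + real (size \<omega>) * Re (cont_rep V g 0))) (dual_lattice V)"
    by (simp del: of_real_power)
  \<comment> \<open>Frequency 0 is split off because its coefficient may be negative; its moment is
    the number of points.\<close>
  then have "((\<lambda>v. Re (fourier_coeff V g v) * (norm (moment v \<omega>))\<^sup>2) has_sum
    (Re (energy (cont_rep V g) \<omega>) + real (size \<omega>) * Re (cont_rep V g 0) -
      Re (fourier_coeff V g 0) * (norm (moment 0 \<omega>))\<^sup>2)) (dual_lattice V - {0})"
    using has_sum_finite[of "{0}" "\<lambda>v. Re (fourier_coeff V g v) * (norm (moment v \<omega>))\<^sup>2"]
    by (intro has_sum_Diff) (auto simp: zero_in_dual_lattice)
  then show ?thesis by (simp add: moment_zero algebra_simps)
qed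

text \<open>The gap between energy and bound is a sum of nonnegative terms: it is nonnegative, and
  zero exactly when every term is.\<close>

lemma cpsd_energy_bound:
  assumes "cpsd V g"
  shows "(real (size \<omega>))\<^sup>2 * Re (fourier_coeff V g 0) - real (size \<omega>) * Re (cont_rep V g 0)
      \<le> Re (energy (cont_rep V g) \<omega>)" (is "?b \<le> ?E")
    and "Re (energy (cont_rep V g) \<omega>) =
      (real (size \<omega>))\<^sup>2 * Re (fourier_coeff V g 0) - real (size \<omega>) * Re (cont_rep V g 0) \<longleftrightarrow>
      (\<forall>v\<in>dual_lattice V - {0}. fourier_coeff V g v * moment v \<omega> = 0)"
proof -
  let ?t = "\<lambda>v. Re (fourier_coeff V g v) * (norm (moment v \<omega>))\<^sup>2"
  have defect: "(?t has_sum (?E - ?b)) (dual_lattice V - {0})"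
    using energy_defect_has_sum[OF assms] .
  have coeff: "fourier_coeff V g v \<in> \<real>\<^sub>\<ge>\<^sub>0" if "v \<in> dual_lattice V - {0}" for v
    using assms that by (auto simp: cpsd_def)
  have nonneg: "?t v \<ge> 0" if "v \<in> dual_lattice V - {0}" for v
    using coeff[OF that] by (auto simp: complex_nonneg_Reals_iff)
  show "?b \<le> ?E" using has_sum_nonneg[OF defect nonneg] by simp
  \<comment> \<open>Away from 0 the coefficient is real, so it vanishes as soon as its real part
    does.\<close>
  have zero: "?t v = 0 \<longleftrightarrow> fourier_coeff V g v * moment v \<omega> = 0"
    if "v \<in> dual_lattice V - {0}" for v
    using coeff[OF that] by (auto simp: complex_nonneg_Reals_iff complex_eq_iff)
  show "?E = ?b \<longleftrightarrow> (\<forall>v\<in>dual_lattice V - {0}. fourier_coeff V g v * moment v \<omega> = 0)"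
  proof
    assume "?E = ?b"
    with defect have "(?t has_sum 0) (dual_lattice V - {0})" by simp
    then have "?t v = 0" if "v \<in> dual_lattice V - {0}" for v
      by (rule nonneg_has_sum_le_0D) (use nonneg that in auto)
    then show "\<forall>v\<in>dual_lattice V - {0}. fourier_coeff V g v * moment v \<omega> = 0"
      using zero by blast
  next
    assume "\<forall>v\<in>dual_lattice V - {0}. fourier_coeff V g v * moment v \<omega> = 0"
    then have "(?t has_sum 0) (dual_lattice V - {0})"
      using zero by (intro has_sum_0) blast
    then show "?E = ?b" using has_sum_unique[OF defect] by fastforce
  qed
qed

theorem proposition7:
  fixes V :: "real^'d^'d"
    and F :: "real^'d \<Rightarrow> ennreal"
    and g :: "real^'d \<Rightarrow> complex"
    and \<omega> :: "(real^'d) multiset"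
    and n :: nat
  assumes nonsingular: "det V \<noteq> 0"
    and F_periodic: "lattice_periodic V F"
    and g_L2: "g \<in> L2_periodic V"
    and g_cpsd: "cpsd V g"
    and g_real: "\<And>x. cont_rep V g x \<in> \<real>"
    and g_le_F: "\<And>x. ereal (Re (cont_rep V g x)) \<le> enn2ereal (F x)"
    and card: "size \<omega> = n"
  defines "E_g \<equiv> Re (energy (cont_rep V g) \<omega>)"
    and "bound \<equiv> (real n)\<^sup>2 * Re (fourier_coeff V g 0) - real n * Re (cont_rep V g 0)"
    and "cond_a \<equiv> \<forall>x\<in>#\<omega>. \<forall>y\<in>#\<omega> - {#x#}. ereal (Re (cont_rep V g (x - y))) = enn2ereal (F (x - y))"
    and "cond_b \<equiv> \<forall>v\<in>dual_lattice V - {0}. fourier_coeff V g v * moment v \<omega> = 0"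
  shows "enn2ereal (energy F \<omega>) \<ge> ereal E_g \<and> E_g \<ge> bound \<and>
         (enn2ereal (energy F \<omega>) = ereal E_g \<and> E_g = bound \<longleftrightarrow> cond_a \<and> cond_b) \<and>
         (cond_a \<and> cond_b \<longrightarrow> energy F \<omega> = min_energy F n)"
proof -
  \<comment> \<open>This is needed for every configuration, since the competitors in the infimum are
    bounded in the same way as \<open>\<omega>\<close>.\<close>
  have lower: "ereal (Re (energy (cont_rep V g) \<omega>')) \<le> enn2ereal (energy F \<omega>')" for \<omega>'
    unfolding Re_energy by (intro energy_ge g_le_F)
  have "bound \<le> E_g" "E_g = bound \<longleftrightarrow> cond_b"
    using cpsd_energy_bound[OF g_cpsd, of \<omega>]
    unfolding E_g_def bound_def cond_b_def card by auto
  moreover have "enn2ereal (energy F \<omega>) = ereal E_g \<longleftrightarrow> cond_a"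
    unfolding E_g_def cond_a_def Re_energy by (intro energy_eq_iff g_le_F)
  moreover have "energy F \<omega> = min_energy F n"
    if eq: "enn2ereal (energy F \<omega>) = ereal bound"
  proof -
    have "energy F \<omega> \<le> energy F \<omega>'" if "size \<omega>' = n" for \<omega>'
    proof -
      \<comment> \<open>A competitor of the same size has the same \<open>bound\<close>, which
        \<open>\<omega>\<close> attains by \<open>eq\<close>.\<close>
      have "ereal bound \<le> ereal (Re (energy (cont_rep V g) \<omega>'))"
        using cpsd_energy_bound(1)[OF g_cpsd, of \<omega>'] that by (simp add: bound_def)
      also note lower
      finally show ?thesis by (simp add: eq less_eq_ennreal.rep_eq)
    qed
    then show ?thesis
      unfolding min_energy_def using card by (intro antisym INF_greatest INF_lower) auto
  qed
  ultimately show ?thesis using lower[of \<omega>] unfolding E_g_def by auto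
qed

end
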